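(* Every hyperbolic geodesic in the upper half-plane $\mathbb{H}$ is a geodesic with respect to the weak metric $\delta$ on $\mathbb{H}$. Conversely, every geodesic with respect to $\delta$ is a hyperbolic geodesic, i.e. a geodesic with respect to the hyperbolic distance $d_{hyp}$.
   Context: $\mathbb{H}=\{z\in\mathbb{C}\mid \mathrm{Im}(z)>0\}$, equipped with the hyperbolic distance $d_{hyp}$ of constant curvature $-4$ (length element $\sqrt{dx^2+dy^2}/(2y)$). The weak metric $\delta$ on $\mathbb{H}$ is defined by $$\delta(\zeta_1,\zeta_2)=\log\sup_{x\in\mathbb{R}}\left|\frac{\zeta_2-x}{\zeta_1-x}\right| .$$ (A weak metric on a set $X$ is a map $X\times X\to\mathbb{R}$ that is nonnegative, vanishes on the diagonal, and satisfies the triangle inequality $\delta(x,z)\le\delta(x,y)+\delta(y,z)$; it need be neither symmetric nor point-separating.) A geodesic with respect to a (possibly weak) metric $d$ on $\mathbb{H}$ is a continuous path $\gamma:I\to\mathbb{H}$, $I\subset\mathbb{R}$ an interval, such that for any three points $\zeta_1=\gamma(t_1),\zeta_2=\gamma(t_2),\zeta_3=\gamma(t_3)$ lying on it in this order ($t_1\le t_2\le t_3$) one has $d(\zeta_1,\zeta_3)=d(\zeta_1,\zeta_2)+d(\zeta_2,\zeta_3)$. A hyperbolic geodesic is a geodesic in this sense for $d=d_{hyp}$; thus geodesics are considered without regard to parametrisation, but with orientation. *)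

theory Defs
  imports "HOL-Analysis.Analysis"
begin

definition upper_half_plane :: "complex set" where
  "upper_half_plane = {z. Im z > 0}"

text \<open>The length element is |dz| / (2 Im z), i.e. the metric has constant curvature -4.\<close>

definition hyp_length :: "(real \<Rightarrow> complex) \<Rightarrow> real" where
  "hyp_length c = integral {0..1} (\<lambda>t. norm (vector_derivative c (at t)) / (2 * Im (c t)))"

text \<open>The distance is the infimum of the lengths of the curves of class C1 on the closed parameter
  interval. The predicate valid_path is deliberately not used: it puts no bound on the derivative near
  the exceptional points, so the integral above could fail to exist (and would then be 0).\<close>

definition hyp_curves :: "complex \<Rightarrow> complex \<Rightarrow> (real \<Rightarrow> complex) set" where
  "hyp_curves z w = {c. c C1_differentiable_on {0..1} \<and> path_image c \<subseteq> upper_half_plane \<and>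
     pathstart c = z \<and> pathfinish c = w}"

definition hyp_dist :: "complex \<Rightarrow> complex \<Rightarrow> real" where
  "hyp_dist z w = (INF c\<in>hyp_curves z w. hyp_length c)"

text \<open>For z in the upper half-plane the quotients below are bounded above, so the real supremum is
  the genuine one.\<close>

definition weak_dist :: "complex \<Rightarrow> complex \<Rightarrow> real" where
  "weak_dist z w = ln (SUP x::real. norm ((w - of_real x) / (z - of_real x)))"

text \<open>The function d need not be symmetric, so the order of its arguments matters.\<close>

definition geodesic_wrt ::
  "(complex \<Rightarrow> complex \<Rightarrow> real) \<Rightarrow> real set \<Rightarrow> (real \<Rightarrow> complex) \<Rightarrow> bool" where
  "geodesic_wrt d I \<gamma> \<longleftrightarrow>
     is_interval I \<and> continuous_on I \<gamma> \<and> \<gamma> ` I \<subseteq> upper_half_plane \<and>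
     (\<forall>t1\<in>I. \<forall>t2\<in>I. \<forall>t3\<in>I. t1 \<le> t2 \<and> t2 \<le> t3 \<longrightarrow>
        d (\<gamma> t1) (\<gamma> t3) = d (\<gamma> t1) (\<gamma> t2) + d (\<gamma> t2) (\<gamma> t3))"

end

theory Submission
  imports Defs
begin

text \<open>On the upper half-plane \<open>weak_dist z w = hyp_dist z w + (ln (Im w) - ln (Im z)) / 2\<close>. The last
  term is a coboundary, so the two distances are additive along the same paths. For the formula,
  consider the Busemann function \<open>busemann x\<close> of a real boundary point \<open>x\<close>. Its hyperbolic gradient
  has norm one, so no curve from \<open>z\<close> to \<open>w\<close> is shorter than \<open>busemann x w - busemann x z\<close>. Equality
  holds for the semicircle or vertical line through \<open>z\<close> and \<open>w\<close> if \<open>x\<close> is the endpoint from which it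
  comes (a downward vertical line comes from infinity, which is the limit of large \<open>x\<close>). The supremum
  over \<open>x\<close> gives the formula.\<close>

definition busemann :: "real \<Rightarrow> complex \<Rightarrow> real" where
  "busemann x z = ln (norm (z - of_real x)) - ln (Im z) / 2"

section \<open>The weak distance and differences of Busemann functions\<close>

lemma minus_of_real_nonzero: "Im z > 0 \<Longrightarrow> z - of_real x \<noteq> 0"
  by (auto simp: complex_eq_iff)

text \<open>Each quotient is \<open>1 + (w - z) / (z - of_real x)\<close>, and a real point
  \<open>x\<close> is at distance at least \<open>Im z\<close> from \<open>z\<close>. Boundedness is
  what makes the real \<open>SUP\<close> an upper bound.\<close>

lemma bdd_above_quotients:
  assumes "Im z > 0"
  shows "bdd_above (range (\<lambda>x::real. norm ((w - of_real x) / (z - of_real x))))"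
proof (intro bdd_aboveI2)
  fix x :: real
  have nz: "z - of_real x \<noteq> 0"
    using assms by (rule minus_of_real_nonzero)
  have ge: "norm (z - of_real x) \<ge> Im z"
    using abs_Im_le_cmod[of "z - of_real x"] by simp
  have "(w - of_real x) / (z - of_real x) = 1 + (w - z) / (z - of_real x)"
    using nz by (simp add: field_simps)
  also have "norm \<dots> \<le> 1 + norm (w - z) / norm (z - of_real x)"
    by (metis norm_divide norm_one norm_triangle_ineq)
  also have "\<dots> \<le> 1 + norm (w - z) / Im z"
    using ge assms by (intro add_left_mono divide_left_mono mult_pos_pos) auto
  finally show "norm ((w - of_real x) / (z - of_real x)) \<le> 1 + norm (w - z) / Im z" .
qed

lemma quotient_le_SUP:
  assumes "Im z > 0"
  shows "norm ((w - of_real x) / (z - of_real x)) \<le>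
    (SUP x::real. norm ((w - of_real x) / (z - of_real x)))"
  by (intro cSUP_upper bdd_above_quotients assms) auto

lemma ln_quotient_eq_busemann:
  assumes "Im z > 0" "Im w > 0"
  shows "ln (norm ((w - of_real x) / (z - of_real x))) =
    busemann x w - busemann x z + (ln (Im w) - ln (Im z)) / 2"
  using minus_of_real_nonzero[OF assms(1), of x] minus_of_real_nonzero[OF assms(2), of x]
  by (simp add: busemann_def norm_divide ln_div field_simps)

lemma weak_dist_ge_busemann:
  assumes "Im z > 0" "Im w > 0"
  shows "busemann x w - busemann x z + (ln (Im w) - ln (Im z)) / 2 \<le> weak_dist z w"
proof -
  have pos: "norm ((w - of_real x) / (z - of_real x)) > 0"
    using minus_of_real_nonzero assms by simp
  moreover have "norm ((w - of_real x) / (z - of_real x)) \<le>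
      (SUP x::real. norm ((w - of_real x) / (z - of_real x)))"
    using assms(1) by (rule quotient_le_SUP)
  ultimately show ?thesis
    unfolding weak_dist_def ln_quotient_eq_busemann[OF assms, symmetric]
    by (subst ln_le_cancel_iff) linarith+
qed

lemma weak_dist_le:
  assumes "Im z > 0" "Im w > 0"
    and le: "\<And>x. busemann x w - busemann x z + (ln (Im w) - ln (Im z)) / 2 \<le> b"
  shows "weak_dist z w \<le> b"
proof -
  let ?q = "\<lambda>x::real. norm ((w - of_real x) / (z - of_real x))"
  have pos: "?q x > 0" for x
    using minus_of_real_nonzero assms by simp
  have "?q x \<le> exp b" for x
    using le[of x] ln_quotient_eq_busemann[OF assms(1,2), of x] pos[of x]
    by (metis exp_le_cancel_iff exp_ln)
  then have "(SUP x. ?q x) \<le> exp b"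
    by (intro cSUP_least) auto
  moreover have "(SUP x. ?q x) > 0"
    using pos[of 0] quotient_le_SUP[OF assms(1)] by (rule less_le_trans)
  ultimately show ?thesis
    unfolding weak_dist_def by (metis exp_gt_zero ln_exp ln_le_cancel_iff)
qed

text \<open>The quotients tend to 1 as \<open>x\<close> tends to infinity. This bound takes the
  place of the Busemann function of the boundary point infinity.\<close>

lemma weak_dist_nonneg:
  assumes "Im z > 0"
  shows "weak_dist z w \<ge> 0"
proof -
  let ?q = "\<lambda>x::real. norm ((w - of_real x) / (z - of_real x))"
  have "filterlim (\<lambda>x::real. - complex_of_real x) at_infinity at_top"
    using filterlim_of_real_at_infinity[where 'a = complex]
    by (simp add: filterlim_at_infinity_conv_norm_at_top)
  then have "filterlim (\<lambda>x::real. z - of_real x) at_infinity at_top"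
    using tendsto_add_filterlim_at_infinity[OF tendsto_const] by fastforce
  then have "((\<lambda>x::real. norm (1 + (w - z) / (z - of_real x))) \<longlongrightarrow> norm (1 + 0::complex)) at_top"
    by (intro tendsto_intros tendsto_divide_0[OF tendsto_const])
  moreover have "1 + (w - z) / (z - of_real x) = (w - of_real x) / (z - of_real x)" for x
    using minus_of_real_nonzero[OF assms, of x] by (simp add: field_simps)
  ultimately have "(?q \<longlongrightarrow> 1) at_top"
    by simp
  moreover have "?q x \<le> (SUP x. ?q x)" for x
    using assms by (rule quotient_le_SUP)
  ultimately have "1 \<le> (SUP x. ?q x)"
    by (intro tendsto_upperbound) auto
  then show ?thesis
    unfolding weak_dist_def by simp
qed

section \<open>Busemann functions bound lengths from below\<close>

text \<open>Read \<open>a + ib\<close> as \<open>z - of_real x\<close> and \<open>p + iq\<close> as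
  a tangent vector at \<open>z\<close>: the left side is the derivative of
  \<open>busemann x\<close>, the right side the hyperbolic norm. Over a common denominator this is
  the Cauchy-Schwarz inequality for \<open>(p, q)\<close> and \<open>(2ab, b^2 - a^2)\<close>, a
  vector of norm \<open>a^2 + b^2\<close>.\<close>

lemma busemann_gradient_le:
  fixes a b p q :: real
  assumes "b > 0"
  shows "(a * p + b * q) / (a\<^sup>2 + b\<^sup>2) - q / (2 * b) \<le> sqrt (p\<^sup>2 + q\<^sup>2) / (2 * b)"
proof -
  have pos: "a\<^sup>2 + b\<^sup>2 > 0"
    using assms by (simp add: add_nonneg_pos)
  have "(2 * a * b * p + (b\<^sup>2 - a\<^sup>2) * q)\<^sup>2 \<le> (a\<^sup>2 + b\<^sup>2)\<^sup>2 * (p\<^sup>2 + q\<^sup>2)"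
  proof -
    have "(a\<^sup>2 + b\<^sup>2)\<^sup>2 * (p\<^sup>2 + q\<^sup>2) - (2 * a * b * p + (b\<^sup>2 - a\<^sup>2) * q)\<^sup>2 =
        ((b\<^sup>2 - a\<^sup>2) * p - 2 * a * b * q)\<^sup>2"
      by algebra
    then show ?thesis
      by (metis diff_ge_0_iff_ge zero_le_power2)
  qed
  then have "2 * a * b * p + (b\<^sup>2 - a\<^sup>2) * q \<le> sqrt ((a\<^sup>2 + b\<^sup>2)\<^sup>2 * (p\<^sup>2 + q\<^sup>2))"
    by (rule real_le_rsqrt)
  also have "\<dots> = (a\<^sup>2 + b\<^sup>2) * sqrt (p\<^sup>2 + q\<^sup>2)"
    using pos by (simp add: real_sqrt_mult)
  finally have "2 * a * b * p + (b\<^sup>2 - a\<^sup>2) * q \<le> (a\<^sup>2 + b\<^sup>2) * sqrt (p\<^sup>2 + q\<^sup>2)" .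
  then have "(2 * a * b * p + (b\<^sup>2 - a\<^sup>2) * q) / ((a\<^sup>2 + b\<^sup>2) * (2 * b)) \<le>
      ((a\<^sup>2 + b\<^sup>2) * sqrt (p\<^sup>2 + q\<^sup>2)) / ((a\<^sup>2 + b\<^sup>2) * (2 * b))"
    using pos assms by (intro divide_right_mono) auto
  moreover have "(2 * a * b * p + (b\<^sup>2 - a\<^sup>2) * q) / ((a\<^sup>2 + b\<^sup>2) * (2 * b)) =
      (a * p + b * q) / (a\<^sup>2 + b\<^sup>2) - q / (2 * b)"
    using pos assms by (simp add: diff_frac_eq) (simp add: algebra_simps power2_eq_square)
  moreover have "((a\<^sup>2 + b\<^sup>2) * sqrt (p\<^sup>2 + q\<^sup>2)) / ((a\<^sup>2 + b\<^sup>2) * (2 * b)) = sqrt (p\<^sup>2 + q\<^sup>2) / (2 * b)"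
    using pos by (intro mult_divide_mult_cancel_left less_imp_neq[symmetric])
  ultimately show ?thesis
    by simp
qed

lemma busemann_eq_Re_Im:
  "busemann x z = (ln ((Re z - x)\<^sup>2 + (Im z)\<^sup>2) - ln (Im z)) / 2" if "Im z > 0"
  using that by (simp add: busemann_def cmod_def ln_sqrt add_nonneg_pos diff_divide_distrib)

lemma busemann_has_derivative_along:
  assumes c: "(c has_vector_derivative v) (at t)" and pos: "Im (c t) > 0"
  shows "((\<lambda>t. (ln ((Re (c t) - x)\<^sup>2 + (Im (c t))\<^sup>2) - ln (Im (c t))) / 2) has_real_derivative
    ((Re (c t) - x) * Re v + Im (c t) * Im v) / ((Re (c t) - x)\<^sup>2 + (Im (c t))\<^sup>2)
      - Im v / (2 * Im (c t))) (at t)"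
proof -
  let ?N = "\<lambda>t. (Re (c t) - x)\<^sup>2 + (Im (c t))\<^sup>2"
  have re: "((\<lambda>t. Re (c t)) has_real_derivative Re v) (at t)"
    and im: "((\<lambda>t. Im (c t)) has_real_derivative Im v) (at t)"
    using c by (auto simp: has_vector_derivative_complex_iff)
  have "(?N has_real_derivative 2 * ((Re (c t) - x) * Re v + Im (c t) * Im v)) (at t)"
    by (rule derivative_eq_intros re im refl)+ simp
  moreover have "?N t > 0"
    using pos by (simp add: add_nonneg_pos)
  ultimately have "((\<lambda>t. (ln (?N t) - ln (Im (c t))) / 2) has_real_derivative
      (1 / ?N t * (2 * ((Re (c t) - x) * Re v + Im (c t) * Im v)) - 1 / Im (c t) * Im v) / 2) (at t)"
    using im pos by (intro DERIV_cdivide DERIV_diff DERIV_ln_divide[THEN DERIV_chain2])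
  moreover have "(1 / n * (2 * y) - 1 / i * q) / 2 = y / n - q / (2 * i)" for n y i q :: real
    by (simp add: diff_divide_distrib)
  ultimately show ?thesis
    by (simp only:)
qed

text \<open>Integrate \<open>busemann_gradient_le\<close> along the curve.\<close>

lemma hyp_length_ge_busemann:
  assumes "c \<in> hyp_curves z w"
  shows "busemann x w - busemann x z \<le> hyp_length c"
proof -
  obtain D where D: "\<And>t. t \<in> {0..1} \<Longrightarrow> (c has_vector_derivative D t) (at t)"
    and contD: "continuous_on {0..1} D"
    using assms unfolding hyp_curves_def C1_differentiable_on_def by blast
  have pos: "Im (c t) > 0" if "t \<in> {0..1}" for t
  proof -
    have "c t \<in> path_image c"
      using that by (simp add: path_image_def)
    then show ?thesis
      using assms by (auto simp: hyp_curves_def upper_half_plane_def)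
  qed
  have ends: "c 0 = z" "c 1 = w"
    using assms by (auto simp: hyp_curves_def pathstart_def pathfinish_def)
  have contc: "continuous_on {0..1} c"
    using D by (intro continuous_at_imp_continuous_on ballI has_vector_derivative_continuous)
  let ?f = "\<lambda>t. (ln ((Re (c t) - x)\<^sup>2 + (Im (c t))\<^sup>2) - ln (Im (c t))) / 2"
  let ?f' = "\<lambda>t. ((Re (c t) - x) * Re (D t) + Im (c t) * Im (D t)) /
    ((Re (c t) - x)\<^sup>2 + (Im (c t))\<^sup>2) - Im (D t) / (2 * Im (c t))"
  have growth: "(?f' has_integral (?f 1 - ?f 0)) {0..1}"
    using busemann_has_derivative_along[OF D pos]
    by (intro fundamental_theorem_of_calculus)
      (auto simp: has_real_derivative_iff_has_vector_derivative
        intro: has_vector_derivative_at_within)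
  have length: "((\<lambda>t. norm (D t) / (2 * Im (c t))) has_integral hyp_length c) {0..1}"
  proof -
    have "(\<lambda>t. norm (D t) / (2 * Im (c t))) integrable_on {0..1}"
      using pos by (intro integrable_continuous_interval continuous_intros contc contD) force
    \<comment> \<open>The derivatives \<open>D t\<close> are two-sided even at 0 and 1, so they
      agree with \<open>vector_derivative c (at t)\<close> on the whole closed interval.\<close>
    moreover have "hyp_length c = integral {0..1} (\<lambda>t. norm (D t) / (2 * Im (c t)))"
      unfolding hyp_length_def
      using vector_derivative_at[OF D] by (intro integral_cong) (simp only:)
    ultimately show ?thesis
      by (simp add: has_integral_integral)
  qed
  have "?f' t \<le> norm (D t) / (2 * Im (c t))" if "t \<in> {0..1}" for t
    using busemann_gradient_le[OF pos[OF that]] by (simp add: cmod_def)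
  then have "?f 1 - ?f 0 \<le> hyp_length c"
    by (rule has_integral_le[OF growth length])
  moreover have "?f 1 - ?f 0 = busemann x w - busemann x z"
    using pos[of 0] pos[of 1] ends by (simp add: busemann_eq_Re_Im)
  ultimately show ?thesis
    by simp
qed

section \<open>Vertical lines and semicircles bound the hyperbolic distance from above\<close>

lemma hyp_dist_le_hyp_length:
  assumes "c \<in> hyp_curves z w"
  shows "hyp_dist z w \<le> hyp_length c"
  unfolding hyp_dist_def
  using assms hyp_length_ge_busemann
  \<comment> \<open>The infimum needs some lower bound for the lengths; the boundary point 0 is an
    arbitrary choice.\<close>
  by (intro cINF_lower bdd_belowI2[of _ "busemann 0 w - busemann 0 z"]) auto

text \<open>Euclidean speed equal to the height means hyperbolic speed 1/2 in curvature -4. The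
  affine change of parameter to \<open>{0..1}\<close> allows \<open>a\<close> and \<open>b\<close>
  in either order.\<close>

lemma hyp_dist_le_unit_speed:
  fixes g g' :: "real \<Rightarrow> complex"
  assumes D: "\<And>u. (g has_vector_derivative g' u) (at u)" and cont: "continuous_on UNIV g'"
    and pos: "\<And>u. Im (g u) > 0" and speed: "\<And>u. norm (g' u) = Im (g u)"
  shows "hyp_dist (g a) (g b) \<le> \<bar>b - a\<bar> / 2"
proof -
  define c where "c = (\<lambda>t. g (a + t * (b - a)))"
  have D': "(c has_vector_derivative (b - a) *\<^sub>R g' (a + t * (b - a))) (at t)" for t
    unfolding c_def
    by (rule vector_diff_chain_at[OF _ D, unfolded o_def])
      (auto intro!: derivative_eq_intros)
  moreover have "continuous_on {0..1} (\<lambda>t. (b - a) *\<^sub>R g' (a + t * (b - a)))"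
    by (intro continuous_intros continuous_on_compose2[OF cont]) auto
  ultimately have "c C1_differentiable_on {0..1}"
    unfolding C1_differentiable_on_def
    by (intro exI[of _ "\<lambda>t. (b - a) *\<^sub>R g' (a + t * (b - a))"] conjI ballI)
  then have "c \<in> hyp_curves (g a) (g b)"
    using pos by (auto simp: hyp_curves_def path_image_def
        upper_half_plane_def pathstart_def pathfinish_def c_def)
  moreover have "norm (vector_derivative c (at t)) / (2 * Im (c t)) = \<bar>b - a\<bar> / 2" for t
    using vector_derivative_at[OF D', of t] pos[of "a + t * (b - a)"]
    by (simp add: speed c_def)
  then have "hyp_length c = \<bar>b - a\<bar> / 2"
    unfolding hyp_length_def by (simp only: integral_const_real) simp
  ultimately show ?thesis
    using hyp_dist_le_hyp_length by metis
qed

text \<open>The parameter is twice the hyperbolic arc length, as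
  \<open>hyp_dist_le_unit_speed\<close> requires; likewise for \<open>semicircle\<close> with
  \<open>r > 0\<close>.\<close>

definition vertical_line :: "real \<Rightarrow> real \<Rightarrow> complex" where
  "vertical_line x u = Complex x (exp u)"

text \<open>For \<open>r > 0\<close> the path runs from the boundary point \<open>m - r\<close> to
  \<open>m + r\<close>.\<close>

definition semicircle :: "real \<Rightarrow> real \<Rightarrow> real \<Rightarrow> complex" where
  "semicircle m r u = Complex (m + r * tanh u) (r / cosh u)"

lemma hyp_dist_vertical_line_le:
  "hyp_dist (vertical_line x a) (vertical_line x b) \<le> \<bar>b - a\<bar> / 2"
proof (rule hyp_dist_le_unit_speed)
  show "(vertical_line x has_vector_derivative Complex 0 (exp u)) (at u)" for u
    unfolding vertical_line_def has_vector_derivative_complex_iff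
    by (auto intro!: derivative_eq_intros)
  show "continuous_on UNIV (\<lambda>u. Complex 0 (exp u))"
    by (intro continuous_intros)
qed (simp_all add: vertical_line_def cmod_def)

lemma sech_sq: "(1 / cosh u)\<^sup>2 = 1 - (tanh u)\<^sup>2" for u :: real
proof -
  have "1 - (tanh u)\<^sup>2 = ((cosh u)\<^sup>2 - (sinh u)\<^sup>2) / (cosh u)\<^sup>2"
    by (simp add: tanh_def power_divide diff_divide_distrib)
  then show ?thesis
    by (simp add: cosh_square_eq power_divide)
qed

lemma hyp_dist_semicircle_le:
  assumes "r > 0"
  shows "hyp_dist (semicircle m r a) (semicircle m r b) \<le> \<bar>b - a\<bar> / 2"
proof -
  let ?g' = "\<lambda>u. Complex (r * (1 - (tanh u)\<^sup>2)) (- r * tanh u / cosh u)"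
  have D: "(semicircle m r has_vector_derivative ?g' u) (at u)" for u
    unfolding semicircle_def has_vector_derivative_complex_iff
    by (auto intro!: derivative_eq_intros simp: tanh_def power2_eq_square field_simps)
  have cont: "continuous_on UNIV ?g'"
    by (intro continuous_intros) auto
  have pos: "Im (semicircle m r u) > 0" for u
    using assms by (simp add: semicircle_def)
  have speed: "norm (?g' u) = Im (semicircle m r u)" for u
  proof -
    have "(r * (1 - (tanh u)\<^sup>2))\<^sup>2 + (- r * tanh u / cosh u)\<^sup>2 = (r / cosh u)\<^sup>2"
    proof -
      have "(r * (1 - (tanh u)\<^sup>2))\<^sup>2 + (- r * tanh u / cosh u)\<^sup>2 =
          r\<^sup>2 * ((1 / cosh u)\<^sup>2)\<^sup>2 + r\<^sup>2 * (tanh u)\<^sup>2 * (1 / cosh u)\<^sup>2"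
        unfolding sech_sq[symmetric] by (simp add: power_mult_distrib power_divide)
      also have "\<dots> = r\<^sup>2 * (1 / cosh u)\<^sup>2"
        unfolding sech_sq by algebra
      finally show ?thesis
        by (simp add: power_divide)
    qed
    then show ?thesis
      using assms by (simp add: cmod_def semicircle_def)
  qed
  show ?thesis
    using D cont pos speed by (rule hyp_dist_le_unit_speed)
qed

text \<open>Along the semicircle the Busemann functions of its endpoints are affine in
  \<open>u\<close> with slopes 1/2 and -1/2. They change at exactly the rate of arc length, so the
  lower bound is attained in both directions.\<close>

lemma busemann_semicircle:
  assumes "r > 0"
  shows "busemann (m - r) (semicircle m r u) = (ln (2 * r) + u) / 2"
    and "busemann (m + r) (semicircle m r u) = (ln (2 * r) - u) / 2"
proof -
  have cosh: "cosh u > 0"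
    by simp
  \<comment> \<open>Stated for general \<open>s\<close> and \<open>c\<close> because
    \<open>s = sinh u\<close> serves one endpoint and \<open>s = - sinh u\<close> the other.\<close>
  have identity: "(r * (s / c) + r)\<^sup>2 + (r / c)\<^sup>2 = 2 * r * (c + s) * (r / c)"
    if "c\<^sup>2 = s\<^sup>2 + 1" "c > 0" for s c :: real
  proof -
    have "(r * (s / c) + r)\<^sup>2 + (r / c)\<^sup>2 = r\<^sup>2 * ((s + c)\<^sup>2 + 1) / c\<^sup>2"
      using \<open>c > 0\<close> by (simp add: field_simps power2_eq_square)
    also have "(s + c)\<^sup>2 + 1 = 2 * (c + s) * c"
      using that(1) by algebra
    finally show ?thesis
      using \<open>c > 0\<close> by (simp add: power2_eq_square)
  qed
  have pos: "Im (semicircle m r u) > 0"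
    using assms by (simp add: semicircle_def)
  have "(r * tanh u + r)\<^sup>2 + (r / cosh u)\<^sup>2 = 2 * r * exp u * (r / cosh u)"
    unfolding cosh_plus_sinh[symmetric] tanh_def
    using cosh_square_eq cosh by (rule identity)
  then show "busemann (m - r) (semicircle m r u) = (ln (2 * r) + u) / 2"
    using assms cosh
    by (simp add: busemann_eq_Re_Im[OF pos]) (simp add: semicircle_def ln_mult ln_div)
  have "(r * tanh u - r)\<^sup>2 + (r / cosh u)\<^sup>2 = 2 * r * exp (- u) * (r / cosh u)"
    using identity[of "cosh u" "- sinh u"] cosh
    by (simp add: cosh_square_eq tanh_def power2_commute cosh_minus_sinh[symmetric])
  then show "busemann (m + r) (semicircle m r u) = (ln (2 * r) - u) / 2"
    using assms cosh
    by (simp add: busemann_eq_Re_Im[OF pos]) (simp add: semicircle_def ln_mult ln_div)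
qed

lemma on_semicircle:
  assumes "Im z > 0" "(Re z - m)\<^sup>2 + (Im z)\<^sup>2 = r\<^sup>2" "r > 0"
  shows "\<exists>u. z = semicircle m r u"
proof
  \<comment> \<open>On the semicircle this ratio is \<open>sinh u\<close>.\<close>
  define s where "s = (Re z - m) / Im z"
  have "cosh (arsinh s) = sqrt (s\<^sup>2 + 1)"
    by (simp add: cosh_arsinh_real)
  also have "s\<^sup>2 + 1 = (r / Im z)\<^sup>2"
    using assms by (simp add: s_def field_simps)
  finally have cosh: "cosh (arsinh s) = r / Im z"
    using assms by simp
  show "z = semicircle m r (arsinh s)"
    using assms cosh by (simp add: semicircle_def complex_eq_iff tanh_def s_def)
qed

section \<open>Comparison of the two distances\<close>

text \<open>The explicit path through \<open>z\<close> and \<open>w\<close> has length given by an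
  absolute value. Each sign of it is matched by the bound on \<open>weak_dist\<close> from one
  endpoint of the path.\<close>

lemma hyp_dist_le_weak_dist:
  assumes z: "Im z > 0" and w: "Im w > 0"
  shows "hyp_dist z w \<le> weak_dist z w - (ln (Im w) - ln (Im z)) / 2"
proof (cases "Re z = Re w")
  case True
  have eqs: "z = vertical_line (Re z) (ln (Im z))" "w = vertical_line (Re z) (ln (Im w))"
    using z w True by (simp_all add: vertical_line_def complex_eq_iff)
  have "hyp_dist z w \<le> \<bar>ln (Im w) - ln (Im z)\<bar> / 2"
    using hyp_dist_vertical_line_le eqs by metis
  \<comment> \<open>The foot of the line settles the upward direction; nonnegativity of
    \<open>weak_dist\<close> settles the downward one.\<close>
  moreover have "ln (Im w) - ln (Im z) \<le> weak_dist z w"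
    using weak_dist_ge_busemann[OF z w, of "Re z"] z w True
    by (simp add: busemann_eq_Re_Im ln_realpow field_simps)
  moreover have "0 \<le> weak_dist z w"
    using z by (rule weak_dist_nonneg)
  ultimately show ?thesis
    by (simp add: abs_if field_simps split: if_splits)
next
  case False
  \<comment> \<open>The centre is the real point equidistant from \<open>z\<close> and
    \<open>w\<close>.\<close>
  define m where "m = ((Re w)\<^sup>2 + (Im w)\<^sup>2 - (Re z)\<^sup>2 - (Im z)\<^sup>2) / (2 * (Re w - Re z))"
  define r where "r = sqrt ((Re z - m)\<^sup>2 + (Im z)\<^sup>2)"
  have r: "r > 0"
    using z by (simp add: r_def add_nonneg_pos)
  have rz: "(Re z - m)\<^sup>2 + (Im z)\<^sup>2 = r\<^sup>2"
    by (simp add: r_def)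
  have "2 * (Re w - Re z) * m = (Re w)\<^sup>2 + (Im w)\<^sup>2 - (Re z)\<^sup>2 - (Im z)\<^sup>2"
    using False by (simp add: m_def)
  with rz have rw: "(Re w - m)\<^sup>2 + (Im w)\<^sup>2 = r\<^sup>2"
    by algebra
  obtain a b where ab: "z = semicircle m r a" "w = semicircle m r b"
    using on_semicircle[OF z rz r] on_semicircle[OF w rw r] by auto
  have "hyp_dist z w \<le> \<bar>b - a\<bar> / 2"
    using hyp_dist_semicircle_le[OF r] ab by simp
  moreover have "(b - a) / 2 + (ln (Im w) - ln (Im z)) / 2 \<le> weak_dist z w"
    using weak_dist_ge_busemann[OF z w, of "m - r"] busemann_semicircle(1)[OF r] ab
    by (simp add: field_simps)
  moreover have "(a - b) / 2 + (ln (Im w) - ln (Im z)) / 2 \<le> weak_dist z w"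
    using weak_dist_ge_busemann[OF z w, of "m + r"] busemann_semicircle(2)[OF r] ab
    by (simp add: field_simps)
  ultimately show ?thesis
    by (simp add: abs_if field_simps split: if_splits)
qed

text \<open>The segment from \<open>z\<close> to \<open>w\<close> stays in the convex half-plane.
  This is needed to bound the infimum in \<open>hyp_dist\<close> from below.\<close>

lemma hyp_curves_nonempty:
  assumes "Im z > 0" "Im w > 0"
  shows "hyp_curves z w \<noteq> {}"
proof -
  have "convex upper_half_plane"
    unfolding upper_half_plane_def by (rule convex_halfspace_Im_gt)
  then have "closed_segment z w \<subseteq> upper_half_plane"
    using assms by (intro closed_segment_subset) (auto simp: upper_half_plane_def)
  then have "linepath z w \<in> hyp_curves z w"
    by (auto simp: hyp_curves_def C1_differentiable_on_def
        intro: has_vector_derivative_linepath_within)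
  then show ?thesis
    by blast
qed

lemma hyp_dist_eq_weak_dist:
  assumes z: "Im z > 0" and w: "Im w > 0"
  shows "hyp_dist z w = weak_dist z w - (ln (Im w) - ln (Im z)) / 2"
proof (rule antisym)
  show "hyp_dist z w \<le> weak_dist z w - (ln (Im w) - ln (Im z)) / 2"
    using assms by (rule hyp_dist_le_weak_dist)
  have "busemann x w - busemann x z \<le> hyp_dist z w" for x
    unfolding hyp_dist_def using hyp_curves_nonempty[OF assms] hyp_length_ge_busemann
    by (intro cINF_greatest)
  then have "weak_dist z w \<le> hyp_dist z w + (ln (Im w) - ln (Im z)) / 2"
    by (intro weak_dist_le[OF assms] add_right_mono)
  then show "weak_dist z w - (ln (Im w) - ln (Im z)) / 2 \<le> hyp_dist z w"
    by simp
qed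

theorem theorem2p1:
  fixes I :: "real set" and \<gamma> :: "real \<Rightarrow> complex"
  shows "(geodesic_wrt hyp_dist I \<gamma> \<longrightarrow> geodesic_wrt weak_dist I \<gamma>) \<and>
         (geodesic_wrt weak_dist I \<gamma> \<longrightarrow> geodesic_wrt hyp_dist I \<gamma>)"
proof (cases "\<gamma> ` I \<subseteq> upper_half_plane")
  case True
  then have eq: "hyp_dist (\<gamma> s) (\<gamma> t) = weak_dist (\<gamma> s) (\<gamma> t) - (ln (Im (\<gamma> t)) - ln (Im (\<gamma> s))) / 2"
    if "s \<in> I" "t \<in> I" for s t
    using that by (intro hyp_dist_eq_weak_dist) (auto simp: upper_half_plane_def)
  \<comment> \<open>The height terms telescope: those at the middle point \<open>\<gamma> s\<close>
    cancel, and the rest agree on both sides.\<close>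
  have "hyp_dist (\<gamma> r) (\<gamma> t) = hyp_dist (\<gamma> r) (\<gamma> s) + hyp_dist (\<gamma> s) (\<gamma> t) \<longleftrightarrow>
      weak_dist (\<gamma> r) (\<gamma> t) = weak_dist (\<gamma> r) (\<gamma> s) + weak_dist (\<gamma> s) (\<gamma> t)"
    if "r \<in> I" "s \<in> I" "t \<in> I" for r s t
    unfolding eq[OF that(1,2)] eq[OF that(1,3)] eq[OF that(2,3)] by (auto simp: field_simps)
  then show ?thesis
    unfolding geodesic_wrt_def by blast
next
  \<comment> \<open>Both predicates demand that the path stay in the half-plane, so neither
    holds.\<close>
  case False
  then show ?thesis
    by (simp add: geodesic_wrt_def)
qed

end
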